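(* Let $u:\mathbb{H}\to\mathbb{R}$ be a convex function. Then, for all $g_0,g\in\mathbb{H}$, $$u(g)=u(g_0)+\sup_{\mathcal{P}}\left\{\sum_{i=0}^{n-1}\langle p_i,\xi_1(g_{i+1})-\xi_1(g_i)\rangle\right\},$$ where $$\mathcal{P}=\Bigl\{\{(g_i,p_i)\}_{i=0}^{n}:\ n>0,\ g_{i+1}\in H_{g_i}\ (0\le i\le n-1),\ g_n=g,\ p_i\in\partial_H u(g_i)\ (0\le i\le n)\Bigr\}$$ is the set of finite sequences as indicated, of arbitrary length $n\geq 1$, whose first point is the given $g_0$.
   Context: The Heisenberg group $\mathbb{H}$ is $\mathbb{R}^3$ with the group law $(x,y,t)(x',y',t')=(x+x',\,y+y',\,t+t'+2(x'y-xy'))$, identity $e=(0,0,0)$, and dilations $\delta_\lambda(x,y,t)=(\lambda x,\lambda y,\lambda^2 t)$. Let $X=\partial_x+2y\,\partial_t$, $Y=\partial_y-2x\,\partial_t$ and $V_1=\mathrm{span}\{X,Y\}$, with the inner product $\langle\cdot,\cdot\rangle$ for which $X,Y$ are orthonormal, and $\xi_1(x,y,t)=xX+yY\in V_1$. For $g_0=(x_0,y_0,t_0)\in\mathbb{H}$ the horizontal plane at $g_0$ is $H_{g_0}=\{(x,y,t): t=t_0+2y_0x-2x_0y\}$. A function $u:\mathbb{H}\to\mathbb{R}$ is convex if $u(g\delta_\lambda(g^{-1}g'))\le u(g)+\lambda(u(g')-u(g))$ for all $g\in\mathbb{H}$, $g'\in H_g$, $\lambda\in[0,1]$. The H-subdifferential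 of $u$ at $g_0$ is $\partial_H u(g_0)=\{p\in V_1:\ u(g)\ge u(g_0)+\langle p,\xi_1(g)-\xi_1(g_0)\rangle\ \ \forall g\in H_{g_0}\}$. *)

theory Defs
  imports "HOL-Analysis.Analysis" "HOL-Library.Extended_Real"
begin

type_synonym heis = "real \<times> real \<times> real"

fun hmult :: "heis \<Rightarrow> heis \<Rightarrow> heis" (infixl "\<cdot>\<^sub>H" 70) where
  "hmult (x, y, t) (x', y', t') = (x + x', y + y', t + t' + 2 * (x' * y - x * y'))"

definition hone :: heis where
  "hone = (0, 0, 0)"

fun hinv :: "heis \<Rightarrow> heis" where
  "hinv (x, y, t) = (- x, - y, - t)"

fun dil :: "real \<Rightarrow> heis \<Rightarrow> heis" where
  "dil l (x, y, t) = (l * x, l * y, l\<^sup>2 * t)"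

lemma hmult_assoc: "(a \<cdot>\<^sub>H b) \<cdot>\<^sub>H c = a \<cdot>\<^sub>H (b \<cdot>\<^sub>H c)"
  by (cases a; cases b; cases c) (simp add: algebra_simps)

lemma hmult_hone: "hone \<cdot>\<^sub>H a = a" "a \<cdot>\<^sub>H hone = a"
  by (cases a; simp add: hone_def)+

lemma hmult_hinv: "hinv a \<cdot>\<^sub>H a = hone" "a \<cdot>\<^sub>H hinv a = hone"
  by (cases a; simp add: hone_def)+

text \<open>A vector field on \<open>\<real>\<^sup>3\<close> is given by its components with respect to
  the coordinate fields \<open>\<partial>\<^sub>x, \<partial>\<^sub>y, \<partial>\<^sub>t\<close>.\<close>

type_synonym vfield = "heis \<Rightarrow> heis"

fun XH :: vfield where
  "XH (x, y, t) = (1, 0, 2 * y)"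

fun YH :: vfield where
  "YH (x, y, t) = (0, 1, - 2 * x)"

definition hcomb :: "real \<Rightarrow> real \<Rightarrow> vfield" where
  "hcomb a b = (\<lambda>g. a *\<^sub>R XH g + b *\<^sub>R YH g)"

definition V1 :: "vfield set" where
  "V1 = {hcomb a b | a b. True}"

text \<open>The inner product on \<^term>\<open>V1\<close> for which \<^term>\<open>XH\<close> and \<^term>\<open>YH\<close> are orthonormal;
  unspecified outside \<^term>\<open>V1\<close>.\<close>

definition V1_inner :: "vfield \<Rightarrow> vfield \<Rightarrow> real" where
  "V1_inner p q =
     (THE s. \<exists>a b c d. p = hcomb a b \<and> q = hcomb c d \<and> s = a * c + b * d)"

lemma hcomb_inject: "hcomb a b = hcomb c d \<longleftrightarrow> a = c \<and> b = d"
proof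
  assume "hcomb a b = hcomb c d"
  then have "hcomb a b (0, 0, 0) = hcomb c d (0, 0, 0)" by simp
  then show "a = c \<and> b = d" by (simp add: hcomb_def)
qed simp

lemma V1_inner_hcomb: "V1_inner (hcomb a b) (hcomb c d) = a * c + b * d"
  unfolding V1_inner_def by (rule the_equality) (auto simp: hcomb_inject)

fun xi1 :: "heis \<Rightarrow> vfield" where
  "xi1 (x, y, t) = hcomb x y"

lemma hcomb_diff: "hcomb a b - hcomb c d = hcomb (a - c) (b - d)"
  by (rule ext) (simp add: hcomb_def algebra_simps)

lemma xi1_diff: "xi1 (x, y, t) - xi1 (x', y', t') = hcomb (x - x') (y - y')"
  by (simp add: hcomb_diff)

fun Hplane :: "heis \<Rightarrow> heis set" where
  "Hplane (x0, y0, t0) = {(x, y, t). t = t0 + 2 * y0 * x - 2 * x0 * y}"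

definition Hconvex :: "(heis \<Rightarrow> real) \<Rightarrow> bool" where
  "Hconvex u \<longleftrightarrow>
     (\<forall>g. \<forall>g'\<in>Hplane g. \<forall>l\<in>{0..1}.
        u (g \<cdot>\<^sub>H dil l (hinv g \<cdot>\<^sub>H g')) \<le> u g + l * (u g' - u g))"

definition Hsubdiff :: "(heis \<Rightarrow> real) \<Rightarrow> heis \<Rightarrow> vfield set" where
  "Hsubdiff u g0 =
     {p \<in> V1. \<forall>g\<in>Hplane g0. u g \<ge> u g0 + V1_inner p (xi1 g - xi1 g0)}"

text \<open>A finite sequence \<open>(\<gamma>\<^sub>i, p\<^sub>i)\<close>, \<open>0 \<le> i \<le> n\<close>, is encoded as a triple
  \<open>(n, \<gamma>, p)\<close>; the values of \<open>\<gamma>\<close> and \<open>p\<close> at indices beyond \<open>n\<close> are arbitrary and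
  play no role.\<close>

definition Hchains ::
  "(heis \<Rightarrow> real) \<Rightarrow> heis \<Rightarrow> heis \<Rightarrow> (nat \<times> (nat \<Rightarrow> heis) \<times> (nat \<Rightarrow> vfield)) set" where
  "Hchains u g0 g =
     {(n, \<gamma>, p). n > 0 \<and> \<gamma> 0 = g0 \<and> \<gamma> n = g \<and>
        (\<forall>i<n. \<gamma> (Suc i) \<in> Hplane (\<gamma> i)) \<and> (\<forall>i\<le>n. p i \<in> Hsubdiff u (\<gamma> i))}"

end

theory Submission
  imports Defs
begin

text \<open>
  A subgradient at \<open>g\<^sub>i\<close> bounds each increment \<open>u(g\<^bsub>i+1\<^esub>) - u(g\<^sub>i)\<close> from below, so every sum in
  \<open>\<P>\<close> is at most \<open>u(g) - u(g\<^sub>0)\<close>. Conversely, on a finely subdivided horizontal segment the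
  subgradient inequalities read backwards, from \<open>g\<^bsub>i+1\<^esub>\<close> to \<open>g\<^sub>i\<close>, show that the sum nearly attains
  the increment, and any two points are joined by finitely many horizontal segments. This needs a
  subgradient at every point. Where a smooth function touches \<open>u\<close> from above, its horizontal
  gradient is a subgradient of \<open>u\<close>. Such points are dense (maximise \<open>u - K |\<cdot> - g\<^sub>0|\<^sup>2\<close> for large
  \<open>K\<close>), and subgradients pass to limits because \<open>u\<close> is continuous. Continuity follows, as for
  ordinary convex functions, from local boundedness above: the horizontal segments joining two
  fixed segments sweep out a surface, and those joining two translates of this surface fill an
  open set.
\<close>

section \<open>Horizontal lines\<close>

text \<open>Written with projections, the product is polynomial in the coordinates, so limit rules
  apply to it directly.\<close>

lemma hmult_eq:
  "g \<cdot>\<^sub>H h = (fst g + fst h, fst (snd g) + fst (snd h),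
     snd (snd g) + snd (snd h) + 2 * (fst h * fst (snd g) - fst g * fst (snd h)))"
  by (cases g; cases h) simp

lemma tendsto_hmult:
  assumes "(G \<longlongrightarrow> a) F" "(H \<longlongrightarrow> b) F"
  shows "((\<lambda>n. G n \<cdot>\<^sub>H H n) \<longlongrightarrow> a \<cdot>\<^sub>H b) F"
  unfolding hmult_eq by (intro tendsto_intros assms)

text \<open>The plane at \<open>g\<close> is the left translate by \<open>g\<close> of the plane of
  points \<open>(v, w, 0)\<close>. All later inequalities are written in these left-invariant
  coordinates \<open>v\<close>, \<open>w\<close>.\<close>

lemma Hplane_iff: "g' \<in> Hplane g \<longleftrightarrow> (\<exists>v w. g' = g \<cdot>\<^sub>H (v, w, 0))"
proof (cases g; cases g')
  fix x y t x' y' t' assume eq: "g = (x, y, t)" "g' = (x', y', t')"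
  show ?thesis
  proof
    assume "g' \<in> Hplane g"
    then have "g' = g \<cdot>\<^sub>H (x' - x, y' - y, 0)"
      by (simp add: eq algebra_simps)
    then show "\<exists>v w. g' = g \<cdot>\<^sub>H (v, w, 0)" by blast
  qed (auto simp: eq algebra_simps)
qed

lemma xi1_diff_horizontal: "xi1 (g \<cdot>\<^sub>H (v, w, 0)) - xi1 g = hcomb v w"
  by (cases g) (simp add: hcomb_diff)

lemma hcomb_in_Hsubdiff_iff:
  "hcomb a b \<in> Hsubdiff u g \<longleftrightarrow> (\<forall>v w. u (g \<cdot>\<^sub>H (v, w, 0)) \<ge> u g + a * v + b * w)"
proof -
  have "hcomb a b \<in> V1" by (auto simp: V1_def)
  moreover have "u g + V1_inner (hcomb a b) (xi1 (g \<cdot>\<^sub>H (v, w, 0)) - xi1 g) = u g + a * v + b * w" for v w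
    by (simp add: xi1_diff_horizontal V1_inner_hcomb)
  ultimately show ?thesis
    unfolding Hsubdiff_def Ball_def Hplane_iff mem_Collect_eq by metis
qed

text \<open>Points \<open>(v, w, 0)\<close> have no third coordinate, so the dilation acts on them
  by ordinary scaling.\<close>

lemma Hconvex_iff:
  "Hconvex u \<longleftrightarrow> (\<forall>g v w. \<forall>l\<in>{0..1}.
     u (g \<cdot>\<^sub>H (l * v, l * w, 0)) \<le> u g + l * (u (g \<cdot>\<^sub>H (v, w, 0)) - u g))"
proof -
  have *: "hinv g \<cdot>\<^sub>H (g \<cdot>\<^sub>H h) = h" for g h
    by (metis hmult_assoc hmult_hinv(1) hmult_hone(1))
  have "dil l (hinv g \<cdot>\<^sub>H (g \<cdot>\<^sub>H (v, w, 0))) = (l * v, l * w, 0)" for l g v w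
    unfolding * by simp
  then show ?thesis
    unfolding Hconvex_def Ball_def Hplane_iff by (metis (no_types, lifting))
qed

section \<open>Left invariance, and ordinary convexity on horizontal lines\<close>

lemma Hconvex_translate:
  assumes "Hconvex u"
  shows "Hconvex (\<lambda>h. u (g \<cdot>\<^sub>H h))"
  using assms unfolding Hconvex_iff hmult_assoc[symmetric] by blast

text \<open>The twist term of the group law vanishes on multiples of one horizontal vector. Hence a
  line through \<open>g\<close> can be re-based at any of its points, where the hypothesis is the
  usual two-point inequality.\<close>

lemma Hconvex_line:
  assumes "Hconvex u"
  shows "convex_on UNIV (\<lambda>s. u (g \<cdot>\<^sub>H (s * v, s * w, 0)))"
proof (rule convex_onI)
  fix l a b :: real assume l: "0 < l" "l < 1"
  then have l': "l \<in> {0..1}" by simp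
  let ?g = "g \<cdot>\<^sub>H (a * v, a * w, 0)"
  have *: "?g \<cdot>\<^sub>H (s * ((b - a) * v), s * ((b - a) * w), 0)
      = g \<cdot>\<^sub>H ((a + s * (b - a)) * v, (a + s * (b - a)) * w, 0)" for s
    by (cases g) (simp add: algebra_simps)
  have "u (?g \<cdot>\<^sub>H (l * ((b - a) * v), l * ((b - a) * w), 0))
      \<le> u ?g + l * (u (?g \<cdot>\<^sub>H ((b - a) * v, (b - a) * w, 0)) - u ?g)"
    using assms l' unfolding Hconvex_iff by blast
  with *[of l] *[of 1] show "u (g \<cdot>\<^sub>H (((1 - l) *\<^sub>R a + l *\<^sub>R b) * v, ((1 - l) *\<^sub>R a + l *\<^sub>R b) * w, 0))
      \<le> (1 - l) * u ?g + l * u (g \<cdot>\<^sub>H (b * v, b * w, 0))"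
    by (simp add: algebra_simps)
qed simp

text \<open>The secant inequality cleared of denominators, so that it also covers
  \<open>a = b\<close>.\<close>

lemma convex_on_three_points:
  fixes f :: "real \<Rightarrow> real"
  assumes f: "convex_on UNIV f" and "a \<le> s" "s \<le> b"
  shows "(b - a) * f s \<le> (b - s) * f a + (s - a) * f b"
proof (cases "a = b")
  case False
  then have ab: "a < b" using assms by simp
  let ?l = "(s - a) / (b - a)"
  have l: "0 \<le> ?l" "?l \<le> 1" using assms ab by (simp_all add: divide_simps)
  have s: "(1 - ?l) * a + ?l * b = s" and l': "1 - ?l = (b - s) / (b - a)"
    using ab by (simp_all add: divide_simps) (simp add: algebra_simps)
  have "f ((1 - ?l) *\<^sub>R a + ?l *\<^sub>R b) \<le> (1 - ?l) * f a + ?l * f b"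
    using l by (intro convex_onD[OF f]) auto
  then have "f s \<le> (b - s) / (b - a) * f a + (s - a) / (b - a) * f b"
    using s l' by simp
  also have "\<dots> = ((b - s) * f a + (s - a) * f b) / (b - a)"
    by (simp add: add_divide_distrib)
  finally show ?thesis using ab by (simp add: pos_le_divide_eq mult.commute)
qed (use assms in simp)

lemma Hconvex_between:
  assumes u: "Hconvex u" and "a \<le> s" "s \<le> b"
    and A: "u (g \<cdot>\<^sub>H (a * v, a * w, 0)) \<le> M" and B: "u (g \<cdot>\<^sub>H (b * v, b * w, 0)) \<le> M"
  shows "u (g \<cdot>\<^sub>H (s * v, s * w, 0)) \<le> M"
proof (cases "a = b")
  case False
  let ?f = "\<lambda>s. u (g \<cdot>\<^sub>H (s * v, s * w, 0))"
  have "(b - a) * ?f s \<le> (b - s) * ?f a + (s - a) * ?f b"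
    using convex_on_three_points[OF Hconvex_line[OF u]] assms by blast
  also have "\<dots> \<le> (b - s) * M + (s - a) * M"
    using assms by (intro add_mono mult_left_mono) auto
  also have "\<dots> = (b - a) * M" by (simp add: algebra_simps)
  finally show ?thesis using assms False by simp
next
  case True
  then have "s = a" using assms by simp
  then show ?thesis using A by simp
qed

section \<open>Continuity\<close>

text \<open>The surface is swept out by the horizontal segments from \<open>(1, y, -2y)\<close> to \<open>(-1, -y, -2y)\<close>,
  with \<open>t = -2y\<close>.\<close>

lemma Hconvex_bounded_surface:
  assumes u: "Hconvex u"
  shows "\<exists>M. \<forall>a t. \<bar>a\<bar> \<le> 1 \<longrightarrow> \<bar>t\<bar> \<le> 2 \<longrightarrow> u (a, - a * t / 2, t) \<le> M"
proof -
  \<comment> \<open>These are the ends of the two generating segments, which run along Y through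
    \<open>(1, 0, 0)\<close> and \<open>(-1, 0, 0)\<close>.\<close>
  define M where "M = Max {u (1, 1, -2), u (1, -1, 2), u (-1, 1, 2), u (-1, -1, -2)}"
  have R: "u (1, y, -2 * y) \<le> M" if "\<bar>y\<bar> \<le> 1" for y
    using Hconvex_between[OF u, of "-1" y 1 "(1, 0, 0)" 0 1 M] that
    by (auto simp: M_def)
  have L: "u (-1, y, 2 * y) \<le> M" if "\<bar>y\<bar> \<le> 1" for y
    using Hconvex_between[OF u, of "-1" y 1 "(-1, 0, 0)" 0 1 M] that
    by (auto simp: M_def)
  \<comment> \<open>The line through \<open>(0, 0, t)\<close> in direction
    \<open>(1, - t / 2)\<close> meets the two segments at \<open>a = 1\<close> and
    \<open>a = -1\<close>.\<close>
  have "u (a, - a * t / 2, t) \<le> M" if "\<bar>a\<bar> \<le> 1" "\<bar>t\<bar> \<le> 2" for a t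
    using Hconvex_between[OF u, of "-1" a 1 "(0, 0, t)" 1 "- t / 2" M]
      R[of "- t / 2"] L[of "t / 2"] that
    by auto
  then show ?thesis by blast
qed

text \<open>The line through \<open>(x, y, t)\<close> in direction \<open>Y\<close> meets the left translates of the surface by
  \<open>(0, \<plusminus>1, 0)\<close> at parameters of opposite sign.\<close>

lemma Hconvex_bounded_near_zero:
  assumes u: "Hconvex u"
  shows "\<exists>M. \<forall>x y t. \<bar>x\<bar> \<le> 1/4 \<longrightarrow> \<bar>y\<bar> \<le> 1/4 \<longrightarrow> \<bar>t\<bar> \<le> 1/4 \<longrightarrow> u (x, y, t) \<le> M"
proof -
  obtain M1 M2 where
    M1: "\<And>a t. \<bar>a\<bar> \<le> 1 \<Longrightarrow> \<bar>t\<bar> \<le> 2 \<Longrightarrow> u ((0, 1, 0) \<cdot>\<^sub>H (a, - a * t / 2, t)) \<le> M1" and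
    M2: "\<And>a t. \<bar>a\<bar> \<le> 1 \<Longrightarrow> \<bar>t\<bar> \<le> 2 \<Longrightarrow> u ((0, -1, 0) \<cdot>\<^sub>H (a, - a * t / 2, t)) \<le> M2"
    using Hconvex_bounded_surface[OF Hconvex_translate[OF u]] by metis
  have "u (x, y, t) \<le> max M1 M2" if b: "\<bar>x\<bar> \<le> 1/4" "\<bar>y\<bar> \<le> 1/4" "\<bar>t\<bar> \<le> 1/4" for x y t
  proof -
    have x2: "0 \<le> x\<^sup>2" "x\<^sup>2 \<le> 1/16"
      using power_mono[of "\<bar>x\<bar>" "1/4" 2] b by (auto simp: power2_eq_square)
    have xt: "\<bar>x * t\<bar> \<le> 1/16"
      using mult_mono[of "\<bar>x\<bar>" "1/4" "\<bar>t\<bar>" "1/4"] b by (simp add: abs_mult)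
    \<comment> \<open>\<open>s c\<close> is the parameter at which the line along Y through
      \<open>(x, y, t)\<close> meets the surface translated by \<open>(0, c, 0)\<close>, found by
      equating the coordinates.\<close>
    define s where "s c = (c * (1 + x\<^sup>2) - x * t / 2 - y) / (1 - x\<^sup>2)" for c :: real
    have s_eq: "s c * (1 - x\<^sup>2) = c * (1 + x\<^sup>2) - x * t / 2 - y" for c
      using x2 by (simp add: s_def)
    \<comment> \<open>Replacing the nonlinear terms by variables \<open>X\<close> and
      \<open>z\<close> leaves only linear arithmetic.\<close>
    have "1 - X > 0 \<and> - 1 * (1 + X) - z / 2 - y \<le> 0 \<and> 0 \<le> 1 * (1 + X) - z / 2 - y \<and>
        \<bar>- 1 * (1 + X) - z / 2 - y\<bar> \<le> 2 * (1 - X) \<and> \<bar>1 * (1 + X) - z / 2 - y\<bar> \<le> 2 * (1 - X)"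
      if "0 \<le> X" "X \<le> 1/16" "\<bar>z\<bar> \<le> 1/16" for X z
      using that b(2) unfolding abs_le_iff by simp
    from this[OF x2 xt] have "1 - x\<^sup>2 > 0"
      "- 1 * (1 + x\<^sup>2) - x * t / 2 - y \<le> 0" "0 \<le> 1 * (1 + x\<^sup>2) - x * t / 2 - y"
      "\<bar>- 1 * (1 + x\<^sup>2) - x * t / 2 - y\<bar> \<le> 2 * (1 - x\<^sup>2)" "\<bar>1 * (1 + x\<^sup>2) - x * t / 2 - y\<bar> \<le> 2 * (1 - x\<^sup>2)"
      by blast+
    then have s: "s (-1) \<le> 0" "0 \<le> s 1" "\<bar>s (-1)\<bar> \<le> 2" "\<bar>s 1\<bar> \<le> 2"
      unfolding s_def abs_divide
      by (simp_all only: divide_nonpos_pos divide_nonneg_pos pos_divide_le_eq abs_of_pos less_imp_le)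
    have pt: "(x, y, t) \<cdot>\<^sub>H (s c * 0, s c * 1, 0)
        = (0, c, 0) \<cdot>\<^sub>H (x, - x * (t - 2 * x * s c - 2 * x * c) / 2, t - 2 * x * s c - 2 * x * c)" for c
      using s_eq[of c] by (simp add: field_simps power2_eq_square)
    \<comment> \<open>The crossing must have its surface parameter in the range where the surface
      bound holds.\<close>
    have bd: "\<bar>t - 2 * x * s c - 2 * x * c\<bar> \<le> 2" if "\<bar>s c\<bar> \<le> 2" "\<bar>c\<bar> \<le> 1" for c
      using mult_mono[of "\<bar>x\<bar>" "1/4" "\<bar>s c\<bar>" 2] mult_mono[of "\<bar>x\<bar>" "1/4" "\<bar>c\<bar>" 1] that b
      by (simp add: abs_mult[symmetric] algebra_simps)
    \<comment> \<open>The point \<open>(x, y, t)\<close> has parameter \<open>0\<close>, which lies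
      between the crossings \<open>s (-1)\<close> and \<open>s 1\<close>.\<close>
    have "u ((x, y, t) \<cdot>\<^sub>H (s 1 * 0, s 1 * 1, 0)) \<le> max M1 M2"
      unfolding pt using M1[OF _ bd[of 1], of x] s b by simp
    moreover have "u ((x, y, t) \<cdot>\<^sub>H (s (-1) * 0, s (-1) * 1, 0)) \<le> max M1 M2"
      unfolding pt using M2[OF _ bd[of "-1"], of x] s b by simp
    ultimately show ?thesis
      using Hconvex_between[OF u s(1,2), of "(x, y, t)" 0 1 "max M1 M2"] by simp
  qed
  then show ?thesis by blast
qed

section \<open>From local upper bounds to continuity\<close>

lemma convex_on_lipschitz_at_zero:
  fixes f :: "real \<Rightarrow> real"
  assumes f: "convex_on UNIV f" and M: "f 1 \<le> M" "f (-1) \<le> M" and s: "\<bar>s\<bar> \<le> 1"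
  shows "\<bar>f s - f 0\<bar> \<le> \<bar>s\<bar> * (M - f 0)"
proof (cases "s \<ge> 0")
  case True
  have "f s \<le> (1 - s) * f 0 + s * f 1"
    using convex_on_three_points[OF f, of 0 s 1] True s by simp
  \<comment> \<open>The lower estimate: \<open>0\<close> lies between \<open>-1\<close> and
    \<open>s\<close>, so a small value at \<open>s\<close> would force a large one at
    \<open>-1\<close>.\<close>
  moreover have "(s + 1) * f 0 \<le> s * f (-1) + f s"
    using convex_on_three_points[OF f, of "-1" 0 s] True by simp
  moreover have "s * f 1 \<le> s * M" "s * f (-1) \<le> s * M"
    using M True by (auto intro: mult_left_mono)
  ultimately show ?thesis using True by (simp add: abs_le_iff algebra_simps)
next
  case False
  have "f s \<le> - (s * f (-1)) + f 0 + s * f 0"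
    using convex_on_three_points[OF f, of "-1" s 0] False s by (simp add: algebra_simps)
  moreover have "f 0 - s * f 0 \<le> f s - s * f 1"
    using convex_on_three_points[OF f, of s 0 1] False by (simp add: algebra_simps)
  moreover have "s * M \<le> s * f 1" "s * M \<le> s * f (-1)"
    using M False by (auto intro: mult_left_mono_neg)
  moreover have "\<bar>s\<bar> * (M - f 0) = s * f 0 - s * M"
    using False by (simp add: algebra_simps)
  ultimately show ?thesis by linarith
qed

text \<open>One horizontal factor with parameter tending to \<open>0\<close> preserves convergence
  of both points and values. Continuity then follows by applying this factor by factor.\<close>

lemma Hconvex_tendsto_step:
  fixes u :: "heis \<Rightarrow> real"
  assumes u: "Hconvex u" and vw: "\<bar>v\<bar> \<le> 1" "\<bar>w\<bar> \<le> 1"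
    and G: "(G \<longlongrightarrow> (0, 0, 0)) F \<and> ((\<lambda>n. u (G n)) \<longlongrightarrow> u (0, 0, 0)) F"
    and S: "(S \<longlongrightarrow> 0) F"
  shows "((\<lambda>n. G n \<cdot>\<^sub>H (S n * v, S n * w, 0)) \<longlongrightarrow> (0, 0, 0)) F \<and>
    ((\<lambda>n. u (G n \<cdot>\<^sub>H (S n * v, S n * w, 0))) \<longlongrightarrow> u (0, 0, 0)) F"
proof
  have "((\<lambda>n. G n \<cdot>\<^sub>H (S n * v, S n * w, 0)) \<longlongrightarrow> (0, 0, 0) \<cdot>\<^sub>H (0 * v, 0 * w, 0)) F"
    by (intro tendsto_hmult tendsto_intros conjunct1[OF G] S)
  then show "((\<lambda>n. G n \<cdot>\<^sub>H (S n * v, S n * w, 0)) \<longlongrightarrow> (0, 0, 0)) F" by simp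
next
  obtain M where M: "\<And>x y t. \<bar>x\<bar> \<le> 1/4 \<Longrightarrow> \<bar>y\<bar> \<le> 1/4 \<Longrightarrow> \<bar>t\<bar> \<le> 1/4 \<Longrightarrow> u (x, y, t) \<le> M"
    using Hconvex_bounded_near_zero[OF u] by blast
  \<comment> \<open>Endpoints at parameter \<open>1/16\<close> and \<open>-1/16\<close> converge
    into the interior of the box where \<open>u\<close> is at most \<open>M\<close>.\<close>
  have near: "\<forall>\<^sub>F n in F. u (G n \<cdot>\<^sub>H (c * v, c * w, 0)) \<le> M" if c: "\<bar>c\<bar> = 1/16" for c
  proof -
    have cvw: "\<bar>c * v\<bar> < 1/4" "\<bar>c * w\<bar> < 1/4"
      unfolding abs_mult c using vw by simp_all
    have "((\<lambda>n. G n \<cdot>\<^sub>H (c * v, c * w, 0)) \<longlongrightarrow> (0, 0, 0) \<cdot>\<^sub>H (c * v, c * w, 0)) F"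
      by (intro tendsto_hmult tendsto_intros conjunct1[OF G])
    then have lim: "((\<lambda>n. G n \<cdot>\<^sub>H (c * v, c * w, 0)) \<longlongrightarrow> (c * v, c * w, 0)) F" by simp
    have "\<forall>\<^sub>F n in F. \<bar>fst (G n \<cdot>\<^sub>H (c * v, c * w, 0))\<bar> < 1/4"
      by (rule order_tendstoD(2)[OF tendsto_rabs[OF tendsto_fst[OF lim]]]) (use cvw in simp)
    moreover have "\<forall>\<^sub>F n in F. \<bar>fst (snd (G n \<cdot>\<^sub>H (c * v, c * w, 0)))\<bar> < 1/4"
      by (rule order_tendstoD(2)[OF tendsto_rabs[OF tendsto_fst[OF tendsto_snd[OF lim]]]]) (use cvw in simp)
    moreover have "\<forall>\<^sub>F n in F. \<bar>snd (snd (G n \<cdot>\<^sub>H (c * v, c * w, 0)))\<bar> < 1/4"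
      by (rule order_tendstoD(2)[OF tendsto_rabs[OF tendsto_snd[OF tendsto_snd[OF lim]]]]) simp
    ultimately show ?thesis
      by eventually_elim (metis M less_imp_le prod.collapse)
  qed
  have "\<forall>\<^sub>F n in F. \<bar>S n\<bar> < 1/16"
    by (rule order_tendstoD(2)[OF tendsto_rabs[OF S]]) simp
  moreover have "\<forall>\<^sub>F n in F. u (G n \<cdot>\<^sub>H (1/16 * v, 1/16 * w, 0)) \<le> M" by (rule near) simp
  moreover have "\<forall>\<^sub>F n in F. u (G n \<cdot>\<^sub>H (- (1/16) * v, - (1/16) * w, 0)) \<le> M" by (rule near) simp
  ultimately have bound: "\<forall>\<^sub>F n in F. norm (u (G n \<cdot>\<^sub>H (S n * v, S n * w, 0)) - u (G n))
      \<le> \<bar>16 * S n\<bar> * (M - u (G n))"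
  proof eventually_elim
    case (elim n)
    have eq0: "G n \<cdot>\<^sub>H (0, 0, 0) = G n" by (cases "G n") simp
    \<comment> \<open>Dividing the direction by 16 moves these endpoints to parameters
      \<open>1\<close> and \<open>-1\<close>.\<close>
    show ?case
      using convex_on_lipschitz_at_zero[OF Hconvex_line[OF u, of "G n" "v/16" "w/16"], of M "16 * S n"] elim
      by (simp add: eq0)
  qed
  have "((\<lambda>n. \<bar>16 * S n\<bar> * (M - u (G n))) \<longlongrightarrow> \<bar>16 * 0\<bar> * (M - u (0, 0, 0))) F"
    by (intro tendsto_intros S conjunct2[OF G])
  then have "((\<lambda>n. \<bar>16 * S n\<bar> * (M - u (G n))) \<longlongrightarrow> 0) F" by simp
  then have "((\<lambda>n. u (G n \<cdot>\<^sub>H (S n * v, S n * w, 0)) - u (G n)) \<longlongrightarrow> 0) F"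
    by (rule Lim_null_comparison[OF bound])
  from tendsto_add[OF this conjunct2[OF G]]
  show "((\<lambda>n. u (G n \<cdot>\<^sub>H (S n * v, S n * w, 0))) \<longlongrightarrow> u (0, 0, 0)) F" by simp
qed

text \<open>The last four factors form a commutator, which is central. Isabelle's \<open>sqrt\<close> is odd, so
  \<open>sqrt \<bar>r\<bar> * sqrt r = r\<close> for all real \<open>r\<close>.\<close>

lemma heis_horizontal_factors:
  fixes x y t :: real
  defines "a \<equiv> sqrt \<bar>t + 2 * x * y\<bar> / 2" and "b \<equiv> - sqrt (t + 2 * x * y) / 2"
  shows "(x, y, t) = (0, 0, 0) \<cdot>\<^sub>H (x * 1, x * 0, 0) \<cdot>\<^sub>H (y * 0, y * 1, 0) \<cdot>\<^sub>H (a * 1, a * 0, 0)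
    \<cdot>\<^sub>H (b * 0, b * 1, 0) \<cdot>\<^sub>H ((- a) * 1, (- a) * 0, 0) \<cdot>\<^sub>H ((- b) * 0, (- b) * 1, 0)"
proof -
  have "sqrt \<bar>r\<bar> * sqrt r = r" for r
    by (cases "r \<ge> 0") (simp_all add: real_sqrt_minus)
  from this[of "t + 2 * x * y"] have "4 * (a * b) = - (t + 2 * x * y)"
    by (simp add: a_def b_def field_simps)
  then show ?thesis by (simp add: algebra_simps)
qed

lemma Hconvex_isCont:
  fixes u :: "heis \<Rightarrow> real"
  assumes "Hconvex u"
  shows "isCont u g"
proof -
  have cont0: "((\<lambda>h. f (fst h, fst (snd h), snd (snd h))) \<longlongrightarrow> f (0, 0, 0)) (at (0, 0, 0))"
    if f: "Hconvex f" for f :: "heis \<Rightarrow> real"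
  proof -
    have x: "((\<lambda>h. fst h) \<longlongrightarrow> 0) (at ((0, 0, 0) :: heis))"
      and y: "((\<lambda>h. fst (snd h)) \<longlongrightarrow> 0) (at ((0, 0, 0) :: heis))"
      by (rule tendsto_eq_intros refl | simp)+
    have a: "((\<lambda>h. sqrt \<bar>snd (snd h) + 2 * fst h * fst (snd h)\<bar> / 2) \<longlongrightarrow> 0) (at ((0, 0, 0) :: heis))"
      and b: "((\<lambda>h. - sqrt (snd (snd h) + 2 * fst h * fst (snd h)) / 2) \<longlongrightarrow> 0) (at ((0, 0, 0) :: heis))"
      by (rule tendsto_eq_intros refl | simp)+
    have base: "((\<lambda>_. (0, 0, 0)) \<longlongrightarrow> (0, 0, 0)) (at ((0, 0, 0) :: heis)) \<and>
        ((\<lambda>_. f (0, 0, 0)) \<longlongrightarrow> f (0, 0, 0)) (at ((0, 0, 0) :: heis))"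
      by simp
    have "\<bar>1\<bar> \<le> (1 :: real)" "\<bar>0\<bar> \<le> (1 :: real)" by simp_all
    note X = Hconvex_tendsto_step[OF f this] and Y = Hconvex_tendsto_step[OF f this(2,1)]
    show ?thesis
      \<comment> \<open>One application per factor of the horizontal decomposition, alternating X
        and Y; all six parameters tend to \<open>0\<close> with \<open>h\<close>.\<close>
      using conjunct2[OF Y[OF X[OF Y[OF X[OF Y[OF X[OF base x] y] a] b]
            tendsto_minus[OF a, unfolded minus_zero]] tendsto_minus[OF b, unfolded minus_zero]]]
      by (simp only: heis_horizontal_factors[symmetric])
  qed
  have lim: "(\<lambda>h. u (g \<cdot>\<^sub>H h)) \<midarrow>(0, 0, 0)\<rightarrow> u (g \<cdot>\<^sub>H (0, 0, 0))"
    using cont0[OF Hconvex_translate[OF assms, of g]] by simp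
  have "isCont (\<lambda>g'. hinv g \<cdot>\<^sub>H g') g"
    unfolding isCont_def by (intro tendsto_hmult tendsto_intros)
  moreover have g0: "hinv g \<cdot>\<^sub>H g = (0, 0, 0)"
    using hmult_hinv(1) by (simp add: hone_def)
  ultimately have "isCont (\<lambda>g'. u (g \<cdot>\<^sub>H (hinv g \<cdot>\<^sub>H g'))) g"
    using lim by (intro isCont_o2[of g "\<lambda>g'. hinv g \<cdot>\<^sub>H g'" "\<lambda>h. u (g \<cdot>\<^sub>H h)"]) (simp_all add: isCont_def)
  then show ?thesis
    by (simp add: hmult_assoc[symmetric] hmult_hinv(2) hmult_hone(1))
qed

section \<open>Existence of subgradients\<close>

text \<open>For \<open>s < 0\<close> the point at \<open>0\<close> lies between those at
  \<open>s\<close> and \<open>1\<close>, so an upper bound behind \<open>g\<close> yields a lower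
  bound ahead of it. Dividing by \<open>- s\<close> and letting \<open>s\<close> tend to
  \<open>0\<close> removes the quadratic error.\<close>

lemma Hconvex_subgradient_if_touched_above:
  fixes u :: "heis \<Rightarrow> real"
  assumes u: "Hconvex u"
    and touch: "\<And>v w. \<forall>\<^sub>F s in at_left 0. u (g \<cdot>\<^sub>H (s * v, s * w, 0)) \<le> u g + s * (a * v + b * w) + s\<^sup>2 * q v w"
  shows "u (g \<cdot>\<^sub>H (v, w, 0)) \<ge> u g + a * v + b * w"
proof -
  let ?f = "\<lambda>s. u (g \<cdot>\<^sub>H (s * v, s * w, 0))"
  have f0: "?f 0 = u g" by (cases g) simp
  have neg: "\<forall>\<^sub>F s in at_left (0 :: real). s < 0"
    by (simp add: eventually_at_filter)
  have "\<forall>\<^sub>F s in at_left 0. u g + (a * v + b * w) + s * q v w \<le> ?f 1"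
    using touch[of v w] neg
  proof eventually_elim
    case (elim s)
    have "(1 - s) * u g \<le> ?f s + - s * ?f 1"
      using convex_on_three_points[OF Hconvex_line[OF u, of g v w], of s 0 1] elim f0 by simp
    then have "(- s) * (u g + (a * v + b * w) + s * q v w) \<le> (- s) * ?f 1"
      using elim by (simp add: algebra_simps power2_eq_square)
    then show ?case using elim by simp
  qed
  moreover have "((\<lambda>s. u g + (a * v + b * w) + s * q v w) \<longlongrightarrow> u g + (a * v + b * w) + 0 * q v w) (at_left 0)"
    by (intro tendsto_intros)
  ultimately have "u g + (a * v + b * w) + 0 * q v w \<le> ?f 1"
    by (intro tendsto_upperbound) auto
  then show ?thesis by simp
qed

lemma Hconvex_subgradient_nearby:
  fixes u :: "heis \<Rightarrow> real"
  assumes u: "Hconvex u" and r: "r > 0"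
  shows "\<exists>g a b. dist g g0 < r \<and> (\<forall>v w. u (g \<cdot>\<^sub>H (v, w, 0)) \<ge> u g + a * v + b * w)"
proof -
  have cont: "continuous_on A u" for A
    using Hconvex_isCont[OF u] by (simp add: continuous_at_imp_continuous_on)
  have ne: "cball g0 r \<noteq> {}" using r by simp
  obtain gM where gM: "\<And>g. g \<in> cball g0 r \<Longrightarrow> u g \<le> u gM"
    using continuous_attains_sup[OF compact_cball ne cont] by blast
  \<comment> \<open>On the boundary sphere the penalty exceeds any possible gain of \<open>u\<close>
    over its value at \<open>g0\<close>, which forces the maximiser into the open ball.\<close>
  define K where "K = (u gM - u g0 + 1) / r\<^sup>2"
  have M: "u g0 \<le> u gM" using gM[of g0] r by simp
  have K: "K > 0" "K * r\<^sup>2 = u gM - u g0 + 1" using M r by (simp_all add: K_def)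
  have contK: "continuous_on (cball g0 r) (\<lambda>g. u g - K * (dist g g0)\<^sup>2)"
    by (intro continuous_intros cont)
  obtain g where g: "g \<in> cball g0 r"
    and max: "\<And>h. h \<in> cball g0 r \<Longrightarrow> u h - K * (dist h g0)\<^sup>2 \<le> u g - K * (dist g g0)\<^sup>2"
    using continuous_attains_sup[OF compact_cball ne contK] by blast
  have "K * (dist g g0)\<^sup>2 < K * r\<^sup>2"
    using max[of g0] gM[OF g] K r by simp
  then have gr: "dist g g0 < r"
    using K(1) r by (simp add: power2_less_imp_less)
  obtain x y t x0 y0 t0 where eq: "g = (x, y, t)" "g0 = (x0, y0, t0)"
    by (metis prod.collapse)
  \<comment> \<open>\<open>a\<close> and \<open>b\<close> are the X and Y derivatives at
    \<open>g\<close> of the penalty, \<open>K\<close> times the squared Euclidean distance to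
    \<open>g0\<close>; \<open>q\<close> is its exact second-order coefficient along the
    line.\<close>
  define a where "a = 2 * K * ((x - x0) + 2 * y * (t - t0))"
  define b where "b = 2 * K * ((y - y0) - 2 * x * (t - t0))"
  define q where "q v w = K * (v\<^sup>2 + w\<^sup>2 + 4 * (v * y - x * w)\<^sup>2)" for v w
  have touch: "\<forall>\<^sub>F s in at_left 0. u (g \<cdot>\<^sub>H (s * v, s * w, 0)) \<le> u g + s * (a * v + b * w) + s\<^sup>2 * q v w"
    for v w
  proof -
    have "((\<lambda>s. g \<cdot>\<^sub>H (s * v, s * w, 0)) \<longlongrightarrow> g \<cdot>\<^sub>H (0 * v, 0 * w, 0)) (at_left 0)"
      by (intro tendsto_hmult tendsto_intros)
    then have "((\<lambda>s. dist (g \<cdot>\<^sub>H (s * v, s * w, 0)) g0) \<longlongrightarrow> dist g g0) (at_left 0)"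
      by (intro tendsto_intros) (simp add: eq)
    then have "\<forall>\<^sub>F s in at_left 0. dist (g \<cdot>\<^sub>H (s * v, s * w, 0)) g0 < r"
      using gr by (rule order_tendstoD)
    then show ?thesis
    proof eventually_elim
      case (elim s)
      have d2: "(dist (p1, p2, p3) (q1, q2, q3))\<^sup>2 = (p1 - q1)\<^sup>2 + (p2 - q2)\<^sup>2 + (p3 - q3)\<^sup>2"
        for p1 p2 p3 q1 q2 q3 :: real
        by (simp add: dist_Pair_Pair dist_real_def)
      have "K * (dist (g \<cdot>\<^sub>H (s * v, s * w, 0)) g0)\<^sup>2 - K * (dist g g0)\<^sup>2 = s * (a * v + b * w) + s\<^sup>2 * q v w"
        by (simp only: eq hmult.simps d2 a_def b_def q_def) (simp add: power2_eq_square algebra_simps)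
      then show ?case using max[of "g \<cdot>\<^sub>H (s * v, s * w, 0)"] elim by (simp add: dist_commute)
    qed
  qed
  show ?thesis
    using gr Hconvex_subgradient_if_touched_above[OF u touch] by blast
qed

text \<open>Subgradients at points tending to \<open>g\<close> stay bounded, and by continuity of
  \<open>u\<close> any limit of a subsequence is a subgradient at \<open>g\<close>.\<close>

lemma Hconvex_subgradient_exists:
  fixes u :: "heis \<Rightarrow> real"
  assumes u: "Hconvex u"
  shows "\<exists>a b. \<forall>v w. u (g \<cdot>\<^sub>H (v, w, 0)) \<ge> u g + a * v + b * w"
proof -
  have "\<exists>G c. dist G g < inverse (real (Suc n)) \<and>
      (\<forall>v w. u (G \<cdot>\<^sub>H (v, w, 0)) \<ge> u G + fst c * v + snd c * w)" for n
    using Hconvex_subgradient_nearby[OF u, of "inverse (real (Suc n))" g] by force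
  then obtain G and c :: "nat \<Rightarrow> real \<times> real" where G: "\<And>n. dist (G n) g < inverse (real (Suc n))"
    and c: "\<And>n v w. u (G n \<cdot>\<^sub>H (v, w, 0)) \<ge> u (G n) + fst (c n) * v + snd (c n) * w"
    by metis
  have "\<forall>n. norm (dist (G n) g) \<le> inverse (real (Suc n))"
    using less_imp_le[OF G] by (simp del: of_nat_Suc)
  then have "(\<lambda>n. dist (G n) g) \<longlonglongrightarrow> 0"
    by (intro Lim_null_comparison[OF _ LIMSEQ_inverse_real_of_nat] always_eventually)
  then have Glim: "G \<longlonglongrightarrow> g" by (rule tendsto_dist_iff[THEN iffD2])
  have ulim: "(\<lambda>n. u (G n)) \<longlonglongrightarrow> u g"
    by (rule isCont_tendsto_compose[OF Hconvex_isCont[OF u] Glim])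
  have uvlim: "(\<lambda>n. u (G n \<cdot>\<^sub>H (v, w, 0))) \<longlonglongrightarrow> u (g \<cdot>\<^sub>H (v, w, 0))" for v w
    by (intro isCont_tendsto_compose[OF Hconvex_isCont[OF u]] tendsto_hmult Glim tendsto_const)
  \<comment> \<open>Each linear functional is bounded above by a convergent difference of values of
    \<open>u\<close>; the directions \<open>1\<close> and \<open>-1\<close> on each axis then bound
    both coefficients.\<close>
  have bdd: "\<exists>B. \<forall>n. fst (c n) * v + snd (c n) * w \<le> B" for v w
  proof -
    have "Bseq (\<lambda>n. u (G n \<cdot>\<^sub>H (v, w, 0)) - u (G n))"
      using tendsto_diff[OF uvlim ulim] by (intro convergent_imp_Bseq convergentI)
    then obtain B where "\<And>n. \<bar>u (G n \<cdot>\<^sub>H (v, w, 0)) - u (G n)\<bar> \<le> B"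
      by (auto simp: Bseq_def)
    then have "fst (c n) * v + snd (c n) * w \<le> B" for n
      using c[of n v w] by (smt (verit))
    then show ?thesis by blast
  qed
  obtain B1 B2 B3 B4 where B: "\<And>n. fst (c n) \<le> B1" "\<And>n. - fst (c n) \<le> B2"
      "\<And>n. snd (c n) \<le> B3" "\<And>n. - snd (c n) \<le> B4"
    using bdd[of 1 0] bdd[of "-1" 0] bdd[of 0 1] bdd[of 0 "-1"] by auto
  have "norm (c n) \<le> (\<bar>B1\<bar> + \<bar>B2\<bar>) + (\<bar>B3\<bar> + \<bar>B4\<bar>)" for n
  proof -
    have "\<bar>fst (c n)\<bar> \<le> \<bar>B1\<bar> + \<bar>B2\<bar>" using B(1,2)[of n] by linarith
    moreover have "\<bar>snd (c n)\<bar> \<le> \<bar>B3\<bar> + \<bar>B4\<bar>" using B(3,4)[of n] by linarith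
    ultimately show ?thesis
      using norm_Pair_le[of "fst (c n)" "snd (c n)"] by simp
  qed
  then have "bounded (range c)" unfolding bounded_iff by blast
  then obtain l and r :: "nat \<Rightarrow> nat" where r: "strict_mono r" and l: "(c \<circ> r) \<longlonglongrightarrow> l"
    using bounded_imp_convergent_subsequence by blast
  have cr: "(\<lambda>n. c (r n)) \<longlonglongrightarrow> l" using l by (simp add: o_def)
  have "u (g \<cdot>\<^sub>H (v, w, 0)) \<ge> u g + fst l * v + snd l * w" for v w
  proof (rule LIMSEQ_le)
    show "(\<lambda>n. u (G (r n) \<cdot>\<^sub>H (v, w, 0))) \<longlonglongrightarrow> u (g \<cdot>\<^sub>H (v, w, 0))"
      using LIMSEQ_subseq_LIMSEQ[OF uvlim r] by (simp add: o_def)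
    show "(\<lambda>n. u (G (r n)) + fst (c (r n)) * v + snd (c (r n)) * w) \<longlonglongrightarrow> u g + fst l * v + snd l * w"
      using LIMSEQ_subseq_LIMSEQ[OF ulim r] by (intro tendsto_intros cr) (simp add: o_def)
  qed (use c in blast)
  then show ?thesis by blast
qed

section \<open>Chains\<close>

definition chain_sum :: "nat \<Rightarrow> (nat \<Rightarrow> heis) \<Rightarrow> (nat \<Rightarrow> vfield) \<Rightarrow> real" where
  "chain_sum n \<gamma> p = (\<Sum>i<n. V1_inner (p i) (xi1 (\<gamma> (Suc i)) - xi1 (\<gamma> i)))"

lemma chain_sum_le:
  assumes "(n, \<gamma>, p) \<in> Hchains u g0 g"
  shows "chain_sum n \<gamma> p \<le> u g - u g0"
proof -
  have "V1_inner (p i) (xi1 (\<gamma> (Suc i)) - xi1 (\<gamma> i)) \<le> u (\<gamma> (Suc i)) - u (\<gamma> i)" if "i < n" for i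
  proof -
    have "\<gamma> (Suc i) \<in> Hplane (\<gamma> i)" "p i \<in> Hsubdiff u (\<gamma> i)"
      using assms that by (auto simp: Hchains_def)
    then show ?thesis unfolding Hsubdiff_def by force
  qed
  then have "chain_sum n \<gamma> p \<le> (\<Sum>i<n. u (\<gamma> (Suc i)) - u (\<gamma> i))"
    unfolding chain_sum_def by (intro sum_mono) auto
  also have "\<dots> = u g - u g0"
    using assms sum_lessThan_telescope[of "\<lambda>i. u (\<gamma> i)" n] by (simp add: Hchains_def)
  finally show ?thesis .
qed

lemma chain_sum_append:
  assumes 1: "(m, \<gamma>, p) \<in> Hchains u a b" and 2: "(n, \<gamma>', p') \<in> Hchains u b c"
  shows "\<exists>k \<delta> q. (k, \<delta>, q) \<in> Hchains u a c \<and> chain_sum k \<delta> q = chain_sum m \<gamma> p + chain_sum n \<gamma>' p'"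
proof -
  define \<delta> where "\<delta> i = (if i < m then \<gamma> i else \<gamma>' (i - m))" for i
  define q where "q i = (if i < m then p i else p' (i - m))" for i
  have c1: "m > 0" "\<gamma> 0 = a" "\<gamma> m = b" "\<And>i. i < m \<Longrightarrow> \<gamma> (Suc i) \<in> Hplane (\<gamma> i)"
      "\<And>i. i \<le> m \<Longrightarrow> p i \<in> Hsubdiff u (\<gamma> i)"
    and c2: "n > 0" "\<gamma>' 0 = b" "\<gamma>' n = c" "\<And>i. i < n \<Longrightarrow> \<gamma>' (Suc i) \<in> Hplane (\<gamma>' i)"
      "\<And>i. i \<le> n \<Longrightarrow> p' i \<in> Hsubdiff u (\<gamma>' i)"
    using 1 2 by (simp_all add: Hchains_def)
  \<comment> \<open>At the junction \<open>i = m\<close> both chains pass through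
    \<open>b\<close>.\<close>
  have \<delta>1: "\<delta> i = \<gamma> i" if "i \<le> m" for i
    using that c1(3) c2(2) by (cases "i = m") (simp_all add: \<delta>_def)
  have \<delta>2: "\<delta> (m + i) = \<gamma>' i" and q2: "q (m + i) = p' i" for i
    by (simp_all add: \<delta>_def q_def)
  have "\<delta> (Suc i) \<in> Hplane (\<delta> i)" if "i < m + n" for i
  proof (cases "i < m")
    case True
    then have "\<delta> i = \<gamma> i" "\<delta> (Suc i) = \<gamma> (Suc i)"
      by (auto intro!: \<delta>1)
    then show ?thesis using c1(4)[OF True] by metis
  next
    case False
    with that have "i = m + (i - m)" "i - m < n" by simp_all
    then obtain j where "i = m + j" "j < n" by blast
    then show ?thesis using c2(4)[of j] \<delta>2[of j] \<delta>2[of "Suc j"] by simp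
  qed
  moreover have "q i \<in> Hsubdiff u (\<delta> i)" if "i \<le> m + n" for i
  proof (cases "i < m")
    case True
    then have "\<delta> i = \<gamma> i" "q i = p i"
      by (auto intro!: \<delta>1 simp: q_def)
    then show ?thesis using c1(5)[of i] True by simp
  next
    case False
    with that have "i = m + (i - m)" "i - m \<le> n" by simp_all
    then obtain j where "i = m + j" "j \<le> n" by blast
    then show ?thesis using c2(5)[of j] by (simp add: \<delta>2 q2)
  qed
  moreover have "\<delta> 0 = a" "\<delta> (m + n) = c" using \<delta>1[of 0] \<delta>2[of n] c1(2) c2(3) by simp_all
  ultimately have "(m + n, \<delta>, q) \<in> Hchains u a c"
    using c1(1) unfolding Hchains_def by blast
  moreover have "chain_sum (m + n) \<delta> q = chain_sum m \<gamma> p + chain_sum n \<gamma>' p'"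
  proof -
    have "chain_sum (m + n) \<delta> q = chain_sum m \<delta> q
        + (\<Sum>i<n. V1_inner (q (m + i)) (xi1 (\<delta> (m + Suc i)) - xi1 (\<delta> (m + i))))"
      unfolding chain_sum_def by (induction n) simp_all
    also have "chain_sum m \<delta> q = chain_sum m \<gamma> p"
      unfolding chain_sum_def by (intro sum.cong) (simp_all add: \<delta>1 q_def)
    finally show ?thesis by (simp only: \<delta>2 q2 chain_sum_def)
  qed
  ultimately show ?thesis by blast
qed

text \<open>The lower half of the formula up to an error \<open>e\<close>, put as a relation between
  points so that it composes along a path.\<close>

definition chain_approx :: "(heis \<Rightarrow> real) \<Rightarrow> heis \<Rightarrow> heis \<Rightarrow> bool" where
  "chain_approx u a b \<longleftrightarrow>
     (\<forall>e>0. \<exists>n \<gamma> p. (n, \<gamma>, p) \<in> Hchains u a b \<and> u b - u a - e \<le> chain_sum n \<gamma> p)"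

lemma chain_approx_trans:
  assumes "chain_approx u a b" "chain_approx u b c"
  shows "chain_approx u a c"
  unfolding chain_approx_def
proof (intro allI impI)
  fix e :: real assume "e > 0"
  then have "e / 2 > 0" by simp
  then obtain m \<gamma> p n \<gamma>' p' where
    1: "(m, \<gamma>, p) \<in> Hchains u a b" "u b - u a - e / 2 \<le> chain_sum m \<gamma> p" and
    2: "(n, \<gamma>', p') \<in> Hchains u b c" "u c - u b - e / 2 \<le> chain_sum n \<gamma>' p'"
    using assms unfolding chain_approx_def by meson
  obtain k \<delta> q where "(k, \<delta>, q) \<in> Hchains u a c"
    "chain_sum k \<delta> q = chain_sum m \<gamma> p + chain_sum n \<gamma>' p'"
    using chain_sum_append[OF 1(1) 2(1)] by blast
  moreover have "u c - u a - e \<le> chain_sum m \<gamma> p + chain_sum n \<gamma>' p'" using 1(2) 2(2) by simp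
  ultimately show "\<exists>n \<gamma> p. (n, \<gamma>, p) \<in> Hchains u a c \<and> u c - u a - e \<le> chain_sum n \<gamma> p"
    by metis
qed

lemma chain_approx_horizontal:
  assumes u: "Hconvex u"
  shows "chain_approx u g (g \<cdot>\<^sub>H (v, w, 0))"
  unfolding chain_approx_def
proof (intro allI impI)
  fix e :: real assume e: "e > 0"
  obtain A B where AB: "\<And>g v w. u (g \<cdot>\<^sub>H (v, w, 0)) \<ge> u g + A g * v + B g * w"
    using Hconvex_subgradient_exists[OF u] by metis
  define pt where "pt s = g \<cdot>\<^sub>H (s * v, s * w, 0)" for s
  define P where "P h = hcomb (A h) (B h)" for h
  define c where "c h = A h * v + B h * w" for h
  have pt_step: "pt s' = pt s \<cdot>\<^sub>H ((s' - s) * v, (s' - s) * w, 0)" for s s'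
    unfolding pt_def by (cases g) (simp add: algebra_simps)
  have incr: "V1_inner (P (pt s)) (xi1 (pt s') - xi1 (pt s)) = (s' - s) * c (pt s)" for s s'
    unfolding P_def c_def by (subst pt_step[of s' s])
      (simp add: xi1_diff_horizontal V1_inner_hcomb algebra_simps)
  \<comment> \<open>This holds for \<open>s' < s\<close> too, which gives the backward reading of
    the inequality.\<close>
  have sub: "u (pt s') \<ge> u (pt s) + (s' - s) * c (pt s)" for s s'
    using AB[of "pt s" "(s' - s) * v" "(s' - s) * w"] pt_step[of s' s] by (simp add: c_def algebra_simps)
  have pt0: "pt 0 = g" by (cases g) (simp add: pt_def)
  have pt1: "pt 1 = g \<cdot>\<^sub>H (v, w, 0)" by (simp add: pt_def)
  define d where "d m = inverse (real (Suc m))" for m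
  have d_lim: "d \<longlonglongrightarrow> 0" unfolding d_def by (rule LIMSEQ_inverse_real_of_nat)
  have "(\<lambda>m. pt (1 - d m)) \<longlonglongrightarrow> g \<cdot>\<^sub>H ((1 - 0) * v, (1 - 0) * w, 0)"
    unfolding pt_def by (intro tendsto_hmult tendsto_intros d_lim)
  then have "(\<lambda>m. pt (1 - d m)) \<longlonglongrightarrow> pt 1" by (simp add: pt_def)
  \<comment> \<open>The backward estimates control every increment but the last, and leave over the
    term \<open>d m * c g\<close> at the start. Both defects vanish as the mesh \<open>d m\<close>
    tends to \<open>0\<close>, the first by continuity of \<open>u\<close>.\<close>
  then have "(\<lambda>m. d m * c g + (u (pt (1 - d m)) - u g)) \<longlonglongrightarrow> 0 * c g + (u (pt 1) - u g)"
    by (intro tendsto_intros d_lim isCont_tendsto_compose[OF Hconvex_isCont[OF u]])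
  then have "\<forall>\<^sub>F m in sequentially. u (pt 1) - u g - e < d m * c g + (u (pt (1 - d m)) - u g)"
    by (rule order_tendstoD) (use e in simp)
  then obtain m where m: "u (pt 1) - u g - e < d m * c g + (u (pt (1 - d m)) - u g)"
    by (auto dest: eventually_happens)
  define \<gamma> where "\<gamma> i = pt (real i * d m)" for i
  have dm: "real (Suc m) * d m = 1" "real m * d m = 1 - d m"
    by (simp_all add: d_def field_simps)
  have "(Suc m, \<gamma>, P \<circ> \<gamma>) \<in> Hchains u g (pt 1)"
  proof -
    have "\<gamma> (Suc i) \<in> Hplane (\<gamma> i)" for i
      unfolding \<gamma>_def Hplane_iff using pt_step by blast
    moreover have "P h \<in> Hsubdiff u h" for h
      unfolding P_def hcomb_in_Hsubdiff_iff using AB by blast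
    ultimately show ?thesis by (simp add: Hchains_def \<gamma>_def pt0 dm del: of_nat_Suc)
  qed
  moreover have "u (pt 1) - u g - e \<le> chain_sum (Suc m) \<gamma> (P \<circ> \<gamma>)"
  proof -
    have "chain_sum (Suc m) \<gamma> (P \<circ> \<gamma>) = (\<Sum>i<Suc m. d m * c (\<gamma> i))"
      unfolding chain_sum_def \<gamma>_def o_def incr by (simp add: algebra_simps)
    \<comment> \<open>Splitting off the initial term shifts the index, so each remaining subgradient
      sits at the right end of its interval.\<close>
    also have "\<dots> = d m * c g + (\<Sum>i<m. d m * c (\<gamma> (Suc i)))"
      unfolding sum.lessThan_Suc_shift by (simp add: \<gamma>_def pt0)
    also have "\<dots> \<ge> d m * c g + (\<Sum>i<m. u (\<gamma> (Suc i)) - u (\<gamma> i))"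
    proof (intro add_left_mono sum_mono)
      fix i
      show "u (\<gamma> (Suc i)) - u (\<gamma> i) \<le> d m * c (\<gamma> (Suc i))"
        using sub[of "real (Suc i) * d m" "real i * d m"] by (simp add: \<gamma>_def algebra_simps)
    qed
    also have "(\<Sum>i<m. u (\<gamma> (Suc i)) - u (\<gamma> i)) = u (pt (1 - d m)) - u g"
      using sum_lessThan_telescope[of "\<lambda>i. u (\<gamma> i)" m] by (simp add: \<gamma>_def pt0 dm)
    finally show ?thesis using m by linarith
  qed
  ultimately show "\<exists>n \<gamma> p. (n, \<gamma>, p) \<in> Hchains u g (g \<cdot>\<^sub>H (v, w, 0)) \<and>
      u (g \<cdot>\<^sub>H (v, w, 0)) - u g - e \<le> chain_sum n \<gamma> p"
    unfolding pt1 by blast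
qed

lemma chain_approx_all:
  assumes u: "Hconvex u"
  shows "chain_approx u g0 g"
proof -
  obtain x y t where h: "hinv g0 \<cdot>\<^sub>H g = (x, y, t)" by (metis prod.collapse)
  have "g = g0 \<cdot>\<^sub>H (x, y, t)"
    unfolding h[symmetric] by (simp add: hmult_assoc[symmetric] hmult_hinv hmult_hone)
  also have "chain_approx u g0 (g0 \<cdot>\<^sub>H (x, y, t))"
    \<comment> \<open>The partial products trace a horizontal path from \<open>g0\<close>; the
      leading factor \<open>(0, 0, 0)\<close> is a step of zero length.\<close>
    unfolding heis_horizontal_factors[of x y t] hmult_assoc[symmetric]
    by (intro chain_approx_trans[OF _ chain_approx_horizontal[OF u]] chain_approx_horizontal[OF u])
  finally show ?thesis .
qed

text \<open>In \<open>ereal\<close> an empty or unbounded family has an infinite supremum, so the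
  equation also asserts that chains exist and that their sums are bounded above.\<close>

theorem theorem6p4:
  fixes u :: "heis \<Rightarrow> real"
  assumes "Hconvex u"
  shows "\<forall>g0 g. ereal (u g) = ereal (u g0) +
    (SUP (n, \<gamma>, p) \<in> Hchains u g0 g.
       ereal (\<Sum>i<n. V1_inner (p i) (xi1 (\<gamma> (Suc i)) - xi1 (\<gamma> i))))"
proof (intro allI)
  fix g0 g
  have "(SUP (n, \<gamma>, p) \<in> Hchains u g0 g. ereal (chain_sum n \<gamma> p)) = ereal (u g - u g0)"
  proof (rule antisym)
    show "(SUP (n, \<gamma>, p) \<in> Hchains u g0 g. ereal (chain_sum n \<gamma> p)) \<le> ereal (u g - u g0)"
      by (rule SUP_least) (auto intro: chain_sum_le)
    show "ereal (u g - u g0) \<le> (SUP (n, \<gamma>, p) \<in> Hchains u g0 g. ereal (chain_sum n \<gamma> p))"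
    proof (rule ereal_le_epsilon2)
      fix e :: real assume "e > 0"
      then obtain n \<gamma> p where c: "(n, \<gamma>, p) \<in> Hchains u g0 g" "u g - u g0 - e \<le> chain_sum n \<gamma> p"
        using chain_approx_all[OF assms, of g0 g] unfolding chain_approx_def by blast
      have "ereal (u g - u g0) \<le> ereal (chain_sum n \<gamma> p) + ereal e" using c(2) by simp
      also have "\<dots> \<le> (SUP (n, \<gamma>, p) \<in> Hchains u g0 g. ereal (chain_sum n \<gamma> p)) + ereal e"
        by (intro add_right_mono SUP_upper2[OF c(1)]) simp
      finally show "ereal (u g - u g0)
        \<le> (SUP (n, \<gamma>, p) \<in> Hchains u g0 g. ereal (chain_sum n \<gamma> p)) + ereal e" .
    qed
  qed
  then show "ereal (u g) = ereal (u g0) + (SUP (n, \<gamma>, p) \<in> Hchains u g0 g.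
       ereal (\<Sum>i<n. V1_inner (p i) (xi1 (\<gamma> (Suc i)) - xi1 (\<gamma> i))))"
    by (simp add: chain_sum_def)
qed

end
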